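(* There exists an infinite family $(\varepsilon_n, d_n, \mathcal{F}_n)$, indexed by infinitely many positive integers $n$, with $\varepsilon_n\in(0,1]$, $d_n$ a positive integer and $\mathcal{F}_n\subseteq\{-1,1\}^n$, such that (a) $\mathrm{VC}(\mathcal{F}_n) = d_n$, and (b) the packing number $M_{\mathcal{F}_n}(\varepsilon_n)$ equals $(1/\varepsilon_n)^{d_n}$.
   Context: On $\{-1,1\}^n$ use the normalized Hamming distance $\rho(x,y) = \frac{1}{n}\,|\{i : x_i \ne y_i\}|$. A subset $S$ is $\varepsilon$-separated if $\rho(x,y)\ge\varepsilon$ for all distinct $x,y\in S$, and the packing number $M_{\mathcal{F}}(\varepsilon)$ is the maximal cardinality of an $\varepsilon$-separated subset of $\mathcal{F}$. For an index sequence $I=(i_1,\dots,i_k)$ of distinct coordinates, $\mathcal{F}$ shatters $I$ if $\{(x_{i_1},\dots,x_{i_k}) : x\in\mathcal{F}\} = \{-1,1\}^k$; $\mathrm{VC}(\mathcal{F})$ is the largest size of a shattered index sequence. *)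

theory Defs
  imports Complex_Main "HOL-Library.FuncSet"
begin

definition cube :: "nat \<Rightarrow> (nat \<Rightarrow> int) set" where
  "cube n = {1..n} \<rightarrow>\<^sub>E {-1, 1}"

definition hamming :: "nat \<Rightarrow> (nat \<Rightarrow> int) \<Rightarrow> (nat \<Rightarrow> int) \<Rightarrow> real" where
  "hamming n x y = real (card {i \<in> {1..n}. x i \<noteq> y i}) / real n"

definition separated :: "nat \<Rightarrow> real \<Rightarrow> (nat \<Rightarrow> int) set \<Rightarrow> bool" where
  "separated n \<epsilon> S \<longleftrightarrow> (\<forall>x\<in>S. \<forall>y\<in>S. x \<noteq> y \<longrightarrow> hamming n x y \<ge> \<epsilon>)"

(* For F a subset of cube n, the set under Max is finite and contains 0. *)
definition packing_number :: "nat \<Rightarrow> (nat \<Rightarrow> int) set \<Rightarrow> real \<Rightarrow> nat" where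
  "packing_number n F \<epsilon> = Max {card S |S. S \<subseteq> F \<and> separated n \<epsilon> S}"

definition shatters :: "nat \<Rightarrow> (nat \<Rightarrow> int) set \<Rightarrow> nat list \<Rightarrow> bool" where
  "shatters n F I \<longleftrightarrow> distinct I \<and> set I \<subseteq> {1..n} \<and>
     {map x I |x. x \<in> F} = {w. length w = length I \<and> set w \<subseteq> {-1, 1}}"

(* A nonempty F shatters the empty sequence, and shattered sequences have length at most n,
   so the maximum exists.  The empty family shatters nothing and its VC dimension is left
   unspecified. *)
definition VC :: "nat \<Rightarrow> (nat \<Rightarrow> int) set \<Rightarrow> nat" where
  "VC n F = Max {length I |I. shatters n F I}"

end

theory Submission
  imports Defs
begin

text \<open>The threshold vectors that are \<open>-1\<close> on the first \<open>k\<close> coordinates and \<open>1\<close> afterwards,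
  for \<open>0 \<le> k < n\<close>, form a family of \<open>n\<close> distinct vectors. Distinct vectors of the cube are at
  distance at least \<open>1/n\<close>, so with \<open>\<epsilon> = 1/n\<close> the packing number is \<open>n = (1/\<epsilon>)^1\<close>. The VC dimension
  is \<open>1\<close>: for coordinates \<open>i < j\<close>, no threshold vector has \<open>1\<close> at \<open>i\<close> and \<open>-1\<close> at \<open>j\<close>.\<close>

lemma finite_cube: "finite (cube n)"
  unfolding cube_def by (intro finite_PiE) auto

lemma separated_cube:
  assumes "S \<subseteq> cube n"
  shows "separated n (1 / real n) S"
  unfolding separated_def hamming_def
proof (intro ballI impI)
  fix x y assume "x \<in> S" "y \<in> S" "x \<noteq> y"
  then obtain i where "i \<in> {1..n}" "x i \<noteq> y i"
    using assms PiE_ext[of x "{1..n}" _ y] unfolding cube_def by blast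
  then have "card {i \<in> {1..n}. x i \<noteq> y i} \<noteq> 0"
    by auto
  then have "1 \<le> real (card {i \<in> {1..n}. x i \<noteq> y i})"
    by linarith
  then show "1 / real n \<le> real (card {i \<in> {1..n}. x i \<noteq> y i}) / real n"
    by (rule divide_right_mono) simp
qed

text \<open>At this scale separation is automatic for every subset of \<open>F\<close>, so the
  maximum runs over all of \<open>Pow F\<close> and is attained at \<open>F\<close> itself.\<close>

lemma packing_number_inverse_dimension:
  assumes "F \<subseteq> cube n"
  shows "packing_number n F (1 / real n) = card F"
proof -
  have fin: "finite F"
    using assms finite_cube finite_subset by blast
  have "{card S |S. S \<subseteq> F \<and> separated n (1 / real n) S} = card ` Pow F"
    using assms separated_cube by blast
  then show ?thesis
    unfolding packing_number_def using fin
    by (auto intro!: Max_eqI card_mono)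
qed

definition threshold :: "nat \<Rightarrow> nat \<Rightarrow> nat \<Rightarrow> int" where
  "threshold n k = (\<lambda>i\<in>{1..n}. if i \<le> k then -1 else 1)"

lemma threshold_apply [simp]:
  "i \<in> {1..n} \<Longrightarrow> threshold n k i = (if i \<le> k then -1 else 1)"
  by (simp add: threshold_def)

lemma threshold_in_cube: "threshold n k \<in> cube n"
  by (auto simp: threshold_def cube_def)

lemma inj_on_threshold: "inj_on (threshold n) {..<n}"
proof (rule linorder_inj_onI)
  fix k l assume "k < l" "k \<in> {..<n}" "l \<in> {..<n}"
  \<comment> \<open>Coordinate \<open>l\<close> tells the two vectors apart;
    \<open>k < l < n\<close> places it in \<open>{1..n}\<close>.\<close>
  then have "threshold n k l \<noteq> threshold n l l"
    by simp
  then show "threshold n k \<noteq> threshold n l"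
    by metis
qed auto

text \<open>With \<open>2 \<le> n\<close> both thresholds \<open>0\<close> and \<open>1\<close>
  occur, and they give coordinate \<open>1\<close> the two signs.\<close>

lemma shatters_threshold_singleton:
  assumes "2 \<le> n"
  shows "shatters n (threshold n ` {..<n}) [1]"
proof -
  have "{map x [1] |x. x \<in> threshold n ` {..<n}} = (\<lambda>k. [threshold n k 1]) ` {..<n}"
    unfolding Setcompr_eq_image image_image by simp
  also have "\<dots> = {[-1], [1]}"
  proof
    show "(\<lambda>k. [threshold n k 1]) ` {..<n} \<subseteq> {[-1], [1]}"
      using assms by auto
    have "[-1] = [threshold n 1 1]" "[1] = [threshold n 0 1]"
      using assms by auto
    then show "{[-1], [1]} \<subseteq> (\<lambda>k. [threshold n k 1]) ` {..<n}"
      using assms by fastforce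
  qed
  also have "\<dots> = {w. length w = length [1::nat] \<and> set w \<subseteq> {-1, 1::int}}"
    by (auto simp: length_Suc_conv)
  finally show ?thesis
    unfolding shatters_def using assms by simp
qed

text \<open>Prescribing signs by a function on coordinates avoids reasoning about positions in
  \<open>I\<close>.\<close>

lemma shatters_map_ex:
  assumes "shatters n F I" "\<And>i. w i \<in> {-1, 1}"
  obtains x where "x \<in> F" "\<And>i. i \<in> set I \<Longrightarrow> x i = w i"
proof -
  have "map w I \<in> {map x I |x. x \<in> F}"
    using assms unfolding shatters_def by auto
  then obtain x where "x \<in> F" "map w I = map x I"
    by blast
  then show thesis
    by (intro that[of x]) auto
qed

lemma shatters_threshold_length:
  assumes sh: "shatters n (threshold n ` K) I"
  shows "length I \<le> 1"
proof (rule ccontr)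
  assume "\<not> length I \<le> 1"
  moreover have I: "distinct I" "set I \<subseteq> {1..n}"
    using sh by (auto simp: shatters_def)
  ultimately have "\<not> card (set I) \<le> Suc 0"
    by (simp add: distinct_card)
  \<comment> \<open>\<open>I\<close> may list its coordinates in any order, so \<open>i\<close> and
    \<open>j\<close> are compared by value, not by position.\<close>
  then obtain i j where ij: "i \<in> set I" "j \<in> set I" "i < j"
    by (metis card_le_Suc0_iff_eq List.finite_set linorder_neqE_nat)
  \<comment> \<open>A pattern descending from \<open>i\<close> to \<open>j\<close>: realising it
    would force \<open>k < i\<close> and \<open>j \<le> k\<close>, against
    \<open>i < j\<close>.\<close>
  define w :: "nat \<Rightarrow> int" where "w = (\<lambda>l. if l = j then -1 else 1)"
  have "w l \<in> {-1, 1}" for l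
    by (simp add: w_def)
  then obtain x where "x \<in> threshold n ` K" and x: "\<And>l. l \<in> set I \<Longrightarrow> x l = w l"
    using shatters_map_ex[OF sh] by blast
  moreover have "x i = 1" "x j = -1"
    using x ij by (auto simp: w_def)
  ultimately obtain k where "threshold n k i = 1" "threshold n k j = -1"
    by blast
  moreover have "i \<in> {1..n}" "j \<in> {1..n}"
    using ij I by auto
  ultimately show False
    using ij by (simp split: if_splits)
qed

lemma VC_threshold:
  assumes "2 \<le> n"
  shows "VC n (threshold n ` {..<n}) = 1"
  unfolding VC_def
proof (rule Max_eqI)
  have "{length I |I. shatters n (threshold n ` {..<n}) I} \<subseteq> {..1}"
    using shatters_threshold_length by blast
  then show "finite {length I |I. shatters n (threshold n ` {..<n}) I}"
    by (rule finite_subset) simp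
  show "1 \<in> {length I |I. shatters n (threshold n ` {..<n}) I}"
    using shatters_threshold_singleton[OF assms] by force
qed (use shatters_threshold_length in blast)

theorem theorem4:
  "\<exists>(N :: nat set) (\<epsilon> :: nat \<Rightarrow> real) (d :: nat \<Rightarrow> nat) (F :: nat \<Rightarrow> (nat \<Rightarrow> int) set).
     infinite N \<and>
     (\<forall>n\<in>N. 0 < n \<and> 0 < \<epsilon> n \<and> \<epsilon> n \<le> 1 \<and> 0 < d n \<and> F n \<subseteq> cube n \<and>
       VC n (F n) = d n \<and>
       real (packing_number n (F n) (\<epsilon> n)) = (1 / \<epsilon> n) ^ d n)"
proof (intro exI conjI ballI)
  \<comment> \<open>The index set starts at \<open>2\<close>, since for \<open>n = 1\<close> the
    family is a single vector of VC dimension \<open>0\<close>. The witnesses stay schematic after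
    \<open>exI\<close> and are fixed by the \<open>show\<close> statements.\<close>
  show "infinite {2::nat..}"
    by (rule infinite_Ici)
  fix n :: nat assume "n \<in> {2..}"
  then have n: "2 \<le> n"
    by simp
  show "0 < n" "0 < 1 / real n" "1 / real n \<le> 1" "0 < (1::nat)"
    using n by auto
  show F: "threshold n ` {..<n} \<subseteq> cube n"
    using threshold_in_cube by blast
  show "VC n (threshold n ` {..<n}) = 1"
    by (rule VC_threshold[OF n])
  show "real (packing_number n (threshold n ` {..<n}) (1 / real n)) = (1 / (1 / real n)) ^ 1"
    by (simp add: packing_number_inverse_dimension[OF F] card_image[OF inj_on_threshold])
qed

end
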